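(* Let $\Delta>0$ be an integer. For all $i,j\in\{0,\dots,\Delta-1\}$ with $\frac{j-i}2\notin\mathbb Z$, $$2^{(i-j)/2}\,\mathcal K^\Delta_{\rm crit}(\Delta-1-i,\Delta-1-j)=\mathcal K_0(i,j).$$
   Context: For $0\le i,j\le\Delta-1$, $$\mathcal K^\Delta_{\rm crit}(i,j)=\sum_{\ell=0}^{\lfloor(\Delta-j-1)/2\rfloor}\begin{cases}\frac1{2\pi}\frac1{\ell!}\sin\frac{\pi(j-i)}2\,\Gamma\bigl(\ell+\frac{j-i}2\bigr)&\text{if }\ell+\frac{j-i}2\notin\mathbb Z_{\le0},\\[2mm]\frac12\frac{(-1)^\ell}{\ell!\,(\frac{i-j}2-\ell)!}&\text{if }\ell+\frac{j-i}2\in\mathbb Z_{\le0}.\end{cases}$$ $\mathcal K_0$ is the (modified) discrete Hermite kernel with parameter $s=0$, with indices shifted to start from $0$: $$\mathcal K_0(i,j)=\frac1{\sqrt{2\pi}\,j!}\int_0^\infty e^{-t^2/2}\,\mathrm{He}_i(t)\,\mathrm{He}_j(t)\,dt ,$$ where $\mathrm{He}_l$ are the probabilist's Hermite polynomials (monic, orthogonal with respect to $e^{-t^2/2}dt$). *)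

theory Defs
  imports
    "HOL-Probability.Probability"
    "HOL-Computational_Algebra.Polynomial"
    "HOL-Library.Nonpos_Ints"
begin

definition monic_gaussian_orthogonal :: "(nat \<Rightarrow> real poly) \<Rightarrow> bool" where
  "monic_gaussian_orthogonal H \<longleftrightarrow>
     (\<forall>n. degree (H n) = n \<and> lead_coeff (H n) = 1) \<and>
     (\<forall>m n. m \<noteq> n \<longrightarrow>
       (LBINT t. exp (- t\<^sup>2 / 2) * poly (H m) t * poly (H n) t) = 0)"

(* Existence and uniqueness, hence well-definedness, are proved below
   (He_monic_gaussian_orthogonal, He_unique). *)
definition He :: "nat \<Rightarrow> real poly" where
  "He = (THE H. monic_gaussian_orthogonal H)"

(* Meaningful for i, j < Delta. In the second case of the summand, (i - j)/2 - l is a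
   nonnegative integer, so taking the floor and converting to nat does not change its value. *)
definition K_crit :: "nat \<Rightarrow> nat \<Rightarrow> nat \<Rightarrow> real" where
  "K_crit \<Delta> i j =
     (\<Sum>l = 0..(\<Delta> - j - 1) div 2.
        if real l + (real j - real i) / 2 \<notin> \<int>\<^sub>\<le>\<^sub>0
        then 1 / (2 * pi) * (1 / fact l) * sin (pi * (real j - real i) / 2)
               * Gamma (real l + (real j - real i) / 2)
        else 1 / 2 * ((-1) ^ l / (fact l * fact (nat \<lfloor>(real i - real j) / 2 - real l\<rfloor>))))"

definition K_0 :: "nat \<Rightarrow> nat \<Rightarrow> real" where
  "K_0 i j = 1 / (sqrt (2 * pi) * fact j) *
     (LBINT t:{0..}. exp (- t\<^sup>2 / 2) * poly (He i) t * poly (He j) t)"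

definition gauss_int :: "real poly \<Rightarrow> real" where
  "gauss_int p = (LBINT t. exp (- t\<^sup>2 / 2) * poly p t)"

lemma gauss_weight_conv: "exp (- t\<^sup>2 / 2) = sqrt (2 * pi) * std_normal_density t"
  by (simp add: std_normal_density_def)

lemma integrable_gauss_poly:
  fixes p :: "real poly"
  shows "integrable lborel (\<lambda>t. exp (- t\<^sup>2 / 2) * poly p t)"
proof -
  have "integrable lborel
          (\<lambda>t. \<Sum>i\<le>degree p. sqrt (2 * pi) * coeff p i * (std_normal_density t * t ^ i))"
    by (intro Bochner_Integration.integrable_sum integrable_mult_right
              integrable_std_normal_moment)
  also have "(\<lambda>t. \<Sum>i\<le>degree p. sqrt (2 * pi) * coeff p i * (std_normal_density t * t ^ i))
               = (\<lambda>t. exp (- t\<^sup>2 / 2) * poly p t)"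
    unfolding gauss_weight_conv poly_altdef by (simp add: sum_distrib_left mult_ac)
  finally show ?thesis .
qed

lemma gauss_int_add: "gauss_int (p + q) = gauss_int p + gauss_int q"
  unfolding gauss_int_def poly_add ring_distribs
  by (rule Bochner_Integration.integral_add[OF integrable_gauss_poly integrable_gauss_poly])

lemma gauss_int_smult: "gauss_int (smult c p) = c * gauss_int p"
  unfolding gauss_int_def by (simp add: mult.left_commute)

lemma gauss_int_diff: "gauss_int (p - q) = gauss_int p - gauss_int q"
  using gauss_int_add[of p "smult (-1) q"] gauss_int_smult[of "-1" q] by simp

lemma gauss_int_0 [simp]: "gauss_int 0 = 0"
  by (simp add: gauss_int_def)

lemma gauss_int_monom:
  "gauss_int (monom 1 k) = sqrt (2 * pi) * (LBINT t. std_normal_density t * t ^ k)"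
  unfolding gauss_int_def gauss_weight_conv by (simp add: poly_monom mult.assoc)

lemma gauss_int_monom_Suc:
  "gauss_int (monom 1 (Suc k)) = gauss_int (pderiv (monom 1 k))"
proof (cases "even k")
  case True
  then obtain m where k: "k = 2 * m" by blast
  have "gauss_int (monom 1 (Suc k)) = 0"
    using integral_std_normal_moment_odd[of m] by (simp add: gauss_int_monom k)
  moreover have "gauss_int (pderiv (monom 1 k)) = 0"
  proof (cases m)
    case 0
    then show ?thesis by (simp add: k pderiv_monom)
  next
    case (Suc m')
    have "gauss_int (monom 1 (Suc (2 * m'))) = 0"
      using integral_std_normal_moment_odd[of m'] by (simp add: gauss_int_monom)
    moreover have "pderiv (monom 1 k) = smult (real k) (monom 1 (Suc (2 * m')))"
      by (simp add: k Suc pderiv_monom smult_monom)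
    ultimately show ?thesis by (simp add: gauss_int_smult)
  qed
  ultimately show ?thesis by simp
next
  case False
  then obtain m where k: "k = 2 * m + 1" by (blast elim: oddE)
  have "pderiv (monom 1 k) = smult (real k) (monom (1::real) (2 * m))"
    by (simp add: k pderiv_monom smult_monom)
  then have "gauss_int (pderiv (monom 1 k))
               = sqrt (2 * pi) * (real k * (fact (2 * m) / (2 ^ m * fact m)))"
    by (simp add: gauss_int_smult gauss_int_monom integral_std_normal_moment_even)
  also have "real k * (fact (2 * m) / (2 ^ m * fact m))
               = fact (2 * Suc m) / (2 ^ Suc m * fact (Suc m))"
    by (simp add: k divide_simps)
  also have "sqrt (2 * pi) * \<dots> = gauss_int (monom 1 (2 * Suc m))"
    by (simp only: gauss_int_monom integral_std_normal_moment_even)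
  finally show ?thesis by (simp add: k)
qed

lemma gauss_int_pCons_0: "gauss_int (pCons 0 p) = gauss_int (pderiv p)"
proof -
  have shift: "pCons 0 (q + r) = pCons 0 q + pCons 0 r" for q r :: "real poly"
    by simp
  have main: "gauss_int (pCons 0 (\<Sum>i\<in>A. monom (c i) i)) = gauss_int (pderiv (\<Sum>i\<in>A. monom (c i) i))"
    if "finite A" for A :: "nat set" and c
    using that
  proof (induction A rule: finite_induct)
    case empty
    then show ?case by simp
  next
    case (insert x F)
    have m: "monom (c x) x = smult (c x) (monom 1 x)"
      by (simp add: smult_monom)
    have "gauss_int (pCons 0 (monom (c x) x)) = c x * gauss_int (monom 1 (Suc x))"
      unfolding m by (simp add: monom_Suc flip: gauss_int_smult)
    also have "\<dots> = gauss_int (pderiv (monom (c x) x))"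
      unfolding m by (simp only: gauss_int_monom_Suc pderiv_smult gauss_int_smult)
    finally have "gauss_int (pCons 0 (monom (c x) x)) = gauss_int (pderiv (monom (c x) x))" .
    then show ?case
      using insert.IH
      by (simp only: sum.insert[OF insert.hyps] pderiv_add gauss_int_add shift)
  qed
  show ?thesis
    using main[of "{..degree p}" "coeff p"] by (simp add: poly_as_sum_of_monoms)
qed

lemma gauss_int_ibp:
  "gauss_int (q * (pCons 0 p - pderiv p)) = gauss_int (pderiv q * p)"
  using gauss_int_pCons_0[of "q * p"]
  by (simp add: gauss_int_diff gauss_int_add pderiv_mult right_diff_distrib mult.commute)

lemma gauss_int_square_eq_0:
  assumes "gauss_int (p * p) = 0"
  shows "p = 0"
proof (rule ccontr)
  assume "p \<noteq> 0"
  have "AE t in lborel. exp (- t\<^sup>2 / 2) * poly (p * p) t = 0"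
    using integral_nonneg_eq_0_iff_AE[OF integrable_gauss_poly, of "p * p"] assms
    by (simp add: gauss_int_def)
  then have "AE t in lborel. poly p t = 0" by simp
  moreover have "AE t in lborel. poly p t \<noteq> 0"
  proof (rule AE_I')
    show "{t. poly p t = 0} \<in> null_sets lborel"
      by (rule finite_imp_null_set_lborel[OF poly_roots_finite[OF \<open>p \<noteq> 0\<close>]])
  qed auto
  ultimately have "AE t in lborel :: real measure. False"
    by eventually_elim simp
  then show False by (simp add: AE_iff_measurable[OF _ refl])
qed

primrec hermite_rec :: "nat \<Rightarrow> real poly" where
  "hermite_rec 0 = 1"
| "hermite_rec (Suc n) = pCons 0 (hermite_rec n) - pderiv (hermite_rec n)"

lemma hermite_rec_coeff:
  "coeff (hermite_rec n) n = 1" "k > n \<Longrightarrow> coeff (hermite_rec n) k = 0"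
proof -
  have "coeff (hermite_rec n) n = 1 \<and> (\<forall>k>n. coeff (hermite_rec n) k = 0)"
  proof (induction n)
    case (Suc n)
    then show ?case
      by (auto simp: coeff_pderiv coeff_pCons split: nat.splits)
  qed simp
  then show "coeff (hermite_rec n) n = 1" "k > n \<Longrightarrow> coeff (hermite_rec n) k = 0"
    by auto
qed

lemma degree_hermite_rec: "degree (hermite_rec n) = n"
proof (rule antisym)
  show "degree (hermite_rec n) \<le> n"
    by (rule degree_le) (simp add: hermite_rec_coeff)
  show "n \<le> degree (hermite_rec n)"
    by (rule le_degree) (simp add: hermite_rec_coeff)
qed

lemma gauss_int_hermite_rec_low:
  "degree q < n \<Longrightarrow> gauss_int (q * hermite_rec n) = 0"
proof (induction n arbitrary: q)
  case (Suc n)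
  have eq: "gauss_int (q * hermite_rec (Suc n)) = gauss_int (pderiv q * hermite_rec n)"
    by (simp add: gauss_int_ibp)
  show ?case
  proof (cases "degree q = 0")
    case True
    then have "pderiv q = 0" by (simp add: pderiv_eq_0_iff)
    then show ?thesis using eq by simp
  next
    case False
    then have "degree (pderiv q) < n" using Suc.prems by (simp add: degree_pderiv)
    then show ?thesis using eq Suc.IH by simp
  qed
qed simp

lemma monic_gaussian_orthogonal_altdef:
  "monic_gaussian_orthogonal H \<longleftrightarrow>
     (\<forall>n. degree (H n) = n \<and> lead_coeff (H n) = 1) \<and>
     (\<forall>m n. m \<noteq> n \<longrightarrow> gauss_int (H m * H n) = 0)"
  by (simp add: monic_gaussian_orthogonal_def gauss_int_def mult.assoc)

lemma monic_gaussian_orthogonal_hermite_rec: "monic_gaussian_orthogonal hermite_rec"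
proof -
  have "gauss_int (hermite_rec m * hermite_rec n) = 0" if "m \<noteq> n" for m n
  proof (cases "m < n")
    case True
    then show ?thesis by (simp add: gauss_int_hermite_rec_low degree_hermite_rec)
  next
    case False
    then have "n < m" using that by simp
    then have "gauss_int (hermite_rec n * hermite_rec m) = 0"
      by (simp add: gauss_int_hermite_rec_low degree_hermite_rec)
    then show ?thesis by (simp add: mult.commute)
  qed
  then show ?thesis
    by (simp add: monic_gaussian_orthogonal_altdef degree_hermite_rec hermite_rec_coeff)
qed

lemma monic_gaussian_orthogonal_low:
  assumes H: "monic_gaussian_orthogonal H"
    and "n \<le> m" "\<And>k. k \<ge> n \<Longrightarrow> coeff q k = 0"
  shows "gauss_int (q * H m) = 0"
  using assms(2,3)
proof (induction n arbitrary: q)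
  case 0
  then have "q = 0" by (simp add: poly_eq_iff)
  then show ?case by simp
next
  case (Suc n)
  define r where "r = q - smult (coeff q n) (H n)"
  have deg: "degree (H n) = n" and lc: "coeff (H n) n = 1"
    using H by (auto simp: monic_gaussian_orthogonal_def dest: spec[of _ n])
  have "coeff r k = 0" if "k \<ge> n" for k
    using that Suc.prems(2)[of k] lc deg
    by (cases "k = n") (auto simp: r_def coeff_eq_0)
  then have "gauss_int (r * H m) = 0"
    using Suc.IH[of r] Suc.prems(1) by simp
  moreover have "gauss_int (H n * H m) = 0"
    using H Suc.prems(1) by (auto simp: monic_gaussian_orthogonal_altdef)
  moreover have "q * H m = r * H m + smult (coeff q n) (H n * H m)"
    by (simp add: r_def algebra_simps)
  ultimately show ?case by (simp add: gauss_int_add gauss_int_smult)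
qed

lemma monic_gaussian_orthogonal_unique:
  assumes H: "monic_gaussian_orthogonal H" and G: "monic_gaussian_orthogonal G"
  shows "H = G"
proof
  fix n
  define D where "D = H n - G n"
  have *: "degree (H n) = n" "coeff (H n) n = 1" "degree (G n) = n" "coeff (G n) n = 1"
    using H G by (auto simp: monic_gaussian_orthogonal_def dest: spec[of _ n])
  have D0: "coeff D k = 0" if "k \<ge> n" for k
    using that * by (cases "k = n") (auto simp: D_def coeff_eq_0)
  have "gauss_int (D * D) = gauss_int (D * H n) - gauss_int (D * G n)"
    by (simp add: D_def right_diff_distrib flip: gauss_int_diff)
  also have "\<dots> = 0"
    using monic_gaussian_orthogonal_low[OF H order_refl D0]
          monic_gaussian_orthogonal_low[OF G order_refl D0] by simp
  finally have "D = 0" by (rule gauss_int_square_eq_0)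
  then show "H n = G n" by (simp add: D_def)
qed

lemma He_eq_hermite_rec: "He = hermite_rec"
  unfolding He_def
  by (rule the_equality[where P = monic_gaussian_orthogonal, OF monic_gaussian_orthogonal_hermite_rec])
     (rule monic_gaussian_orthogonal_unique[OF _ monic_gaussian_orthogonal_hermite_rec])

lemma He_monic_gaussian_orthogonal: "monic_gaussian_orthogonal He"
  by (simp add: He_eq_hermite_rec monic_gaussian_orthogonal_hermite_rec)

lemma He_unique: "monic_gaussian_orthogonal H \<Longrightarrow> H = He"
  using He_monic_gaussian_orthogonal monic_gaussian_orthogonal_unique by blast

end

(* The weight w(t) = exp(-t^2/2) turns the Hermite equation into (w He_n')' = -n w He_n, so
   w (He_i' He_j - He_i He_j') is an antiderivative of (j - i) w He_i He_j, and the integral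
   in K_0 only involves the values of Hermite polynomials at 0. On the other side, with
   a = (i - j)/2, the sum of Gamma(l + a)/l! over l <= L telescopes to Gamma(L + a + 1)/(L! a).
   Since i - j is odd, this Gamma value is at a half-integer, and the two closed forms agree. *)

theory Submission
  imports Defs "HOL-Real_Asymp.Real_Asymp"
begin

section \<open>Derivatives of Hermite polynomials and their values at 0\<close>

lemma pderiv_hermite_rec_Suc:
  "pderiv (hermite_rec (Suc n)) = smult (real (Suc n)) (hermite_rec n)"
proof (induction n)
  case 0
  show ?case by (simp add: pderiv_pCons)
next
  case (Suc n)
  have "pderiv (hermite_rec (Suc (Suc n)))
      = hermite_rec (Suc n) + (pCons 0 (pderiv (hermite_rec (Suc n))) - pderiv (pderiv (hermite_rec (Suc n))))"
    by (subst hermite_rec.simps(2)) (simp only: pderiv_diff pderiv_pCons add_diff_eq)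
  \<comment> \<open>By the induction hypothesis the bracket is \<open>Suc n\<close> times the
    defining recurrence at \<open>n\<close>.\<close>
  also have "\<dots> = hermite_rec (Suc n) + smult (real (Suc n)) (hermite_rec (Suc n))"
    unfolding Suc.IH pderiv_smult by (simp add: smult_diff_right del: of_nat_Suc)
  also have "\<dots> = smult (real (Suc (Suc n))) (hermite_rec (Suc n))"
    by (simp only: of_nat_Suc[of "Suc n"] smult_add_left smult_1_left)
  finally show ?case .
qed

text \<open>Differentiating the recurrence H_(n+1) = t H_n - H_n' gives H_n + t H_n' - H_n''.
  Comparing this with (n+1) H_n cancels one copy of H_n.\<close>

lemma hermite_rec_ode:
  "pCons 0 (pderiv (hermite_rec n)) - pderiv (pderiv (hermite_rec n)) = smult (real n) (hermite_rec n)"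
  using pderiv_hermite_rec_Suc[of n]
  by (simp add: pderiv_pCons pderiv_diff smult_add_left add_diff_eq[symmetric])

lemma poly_hermite_rec_Suc_0:
  "poly (hermite_rec (Suc n)) 0 = - poly (pderiv (hermite_rec n)) 0"
  by simp

text \<open>At 0 the recurrence reads H_(k+1)(0) = - H_k'(0) = - k H_(k-1)(0), so values propagate
  in steps of two from H_0(0) = 1 and H_1(0) = 0.\<close>

lemma poly_hermite_rec_even_odd_0:
  "poly (hermite_rec (2 * m)) 0 = (-1) ^ m * fact (2 * m) / (2 ^ m * fact m)"
  "poly (hermite_rec (Suc (2 * m))) 0 = 0"
proof (induction m)
  case 0
  { case 1 show ?case by simp }
  { case 2 show ?case by simp }
next
  case (Suc m)
  have e: "2 * Suc m = Suc (Suc (2 * m))" by simp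
  { case 1
    show ?case
      unfolding e poly_hermite_rec_Suc_0[of "Suc (2 * m)"] pderiv_hermite_rec_Suc poly_smult Suc.IH(1)
      by (simp add: divide_simps) }
  { case 2
    show ?case
      unfolding e poly_hermite_rec_Suc_0[of "Suc (Suc (2 * m))"] pderiv_hermite_rec_Suc poly_smult Suc.IH(2)
      by simp }
qed

section \<open>Gaussian integrals over the half-line\<close>

lemma tendsto_gauss_poly_at_top:
  fixes p :: "real poly"
  shows "((\<lambda>t. exp (- t\<^sup>2 / 2) * poly p t) \<longlongrightarrow> 0) at_top"
proof -
  have "((\<lambda>t. \<Sum>k\<le>degree p. coeff p k * (exp (- t\<^sup>2 / 2) * t ^ k)) \<longlongrightarrow> (\<Sum>k\<le>degree p. coeff p k * 0)) at_top"
  proof (intro tendsto_sum tendsto_mult_left)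
    fix k :: nat
    show "((\<lambda>t::real. exp (- t\<^sup>2 / 2) * t ^ k) \<longlongrightarrow> 0) at_top"
      by real_asymp
  qed
  then show ?thesis
    by (simp add: poly_altdef sum_distrib_left mult_ac)
qed

text \<open>The integrand w (t p - p') has the antiderivative - w p, which vanishes at infinity, so
  only the boundary term at 0 survives.\<close>

lemma half_line_gauss_int:
  fixes p :: "real poly"
  shows "(LBINT t:{0..}. exp (- t\<^sup>2 / 2) * poly (pCons 0 p - pderiv p) t) = poly p 0"
proof -
  let ?f = "\<lambda>t. exp (- t\<^sup>2 / 2) * poly (pCons 0 p - pderiv p) t"
  let ?F = "\<lambda>t. - (exp (- t\<^sup>2 / 2) * poly p t)"
  \<comment> \<open>Dropping the null set {0} gives the open half-line on which interval integrals
    are defined.\<close>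
  have "(LBINT t:{0..}. ?f t) = (LBINT t:{0<..}. ?f t)"
    by (rule set_integral_discrete_difference[where X = "{0}"]) auto
  also have "\<dots> = (LBINT t=ereal 0..\<infinity>. ?f t)"
    by (rule interval_integral_to_infinity_eq[symmetric])
  also have "\<dots> = 0 - ?F 0"
  proof (rule interval_integral_FTC_integrable)
    show "(?F has_vector_derivative ?f t) (at t)" for t
      unfolding has_real_derivative_iff_has_vector_derivative[symmetric]
      by (auto intro!: derivative_eq_intros poly_DERIV simp: algebra_simps)
    show "isCont ?f t" for t
      by (intro continuous_intros) auto
    show "set_integrable lborel (einterval (ereal 0) \<infinity>) ?f"
      unfolding set_integrable_def
      by (intro integrable_mult_indicator integrable_gauss_poly) auto
    have "isCont ?F 0" by (intro continuous_intros) auto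
    then have "(?F \<longlongrightarrow> ?F 0) (at_right 0)"
      by (simp add: isCont_def filterlim_at_split)
    then show "((?F \<circ> real_of_ereal) \<longlongrightarrow> ?F 0) (at_right (ereal 0))"
      by (simp add: ereal_tendsto_simps)
    show "((?F \<circ> real_of_ereal) \<longlongrightarrow> 0) (at_left \<infinity>)"
      using tendsto_minus[OF tendsto_gauss_poly_at_top[of p]]
      by (simp add: ereal_tendsto_simps)
  qed auto
  finally show ?thesis by simp
qed

text \<open>Apply the boundary formula to the Wronskian p = H_i H_j' - H_i' H_j. The terms H_i' H_j'
  cancel in p', and the Hermite equation turns t p - p' into (j - i) H_i H_j. The boundary value
  p(0) is rewritten with H_k'(0) = - H_(k+1)(0).\<close>

lemma half_line_hermite_rec:
  "(real j - real i) * (LBINT t:{0..}. exp (- t\<^sup>2 / 2) * poly (hermite_rec i) t * poly (hermite_rec j) t)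
     = poly (hermite_rec j) 0 * poly (hermite_rec (Suc i)) 0 - poly (hermite_rec i) 0 * poly (hermite_rec (Suc j)) 0"
proof -
  let ?p = "hermite_rec i * pderiv (hermite_rec j) - pderiv (hermite_rec i) * hermite_rec j"
  have "pCons 0 ?p - pderiv ?p
      = hermite_rec i * (pCons 0 (pderiv (hermite_rec j)) - pderiv (pderiv (hermite_rec j)))
      - hermite_rec j * (pCons 0 (pderiv (hermite_rec i)) - pderiv (pderiv (hermite_rec i)))"
    by (simp add: poly_eq_poly_eq_iff[symmetric] fun_eq_iff pderiv_diff pderiv_mult algebra_simps)
  also have "\<dots> = smult (real j - real i) (hermite_rec i * hermite_rec j)"
    unfolding hermite_rec_ode by (simp add: smult_diff_left mult.commute)
  finally have "poly ?p 0
      = (LBINT t:{0..}. exp (- t\<^sup>2 / 2) * poly (smult (real j - real i) (hermite_rec i * hermite_rec j)) t)"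
    using half_line_gauss_int[of ?p] by simp
  also have "\<dots> = (LBINT t:{0..}. (real j - real i) * (exp (- t\<^sup>2 / 2) * poly (hermite_rec i) t * poly (hermite_rec j) t))"
    by (simp add: mult_ac)
  finally show ?thesis by (simp add: set_integral_mult_right mult.commute)
qed

section \<open>Evaluation of the sum in \<open>K_crit\<close>\<close>

lemma sum_Gamma_shift_over_fact:
  fixes a :: real
  assumes "a \<notin> \<int>"
  shows "(\<Sum>l=0..L. Gamma (real l + a) / fact l) = Gamma (real L + a + 1) / (fact L * a)"
proof (induction L)
  case 0
  have "a \<noteq> 0" "a \<notin> \<int>\<^sub>\<le>\<^sub>0" using assms nonpos_Ints_Int by auto
  then show ?case using Gamma_plus1[of a] by (simp add: field_simps)
next
  case (Suc L)
  have "real (Suc L) + a \<notin> \<int>"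
    using assms by (simp add: add_in_Ints_iff_right)
  then have "Gamma (real (Suc L) + a + 1) = (real (Suc L) + a) * Gamma (real (Suc L) + a)"
    using Gamma_plus1 nonpos_Ints_Int by blast
  moreover have "real L + a + 1 = real (Suc L) + a" by simp
  moreover have "a \<noteq> 0" using assms by auto
  \<comment> \<open>With x = L + 1 + a, the two terms Gamma(x)/(L! a) and Gamma(x)/(L+1)! add up to
    x Gamma(x)/((L+1)! a).\<close>
  ultimately show ?case
    unfolding sum.atLeast0_atMost_Suc Suc.IH by (simp add: divide_simps) (simp add: algebra_simps)
qed

lemma Gamma_nat_plus_half:
  "Gamma (real n + 1 / 2) = fact (2 * n) * sqrt pi / (4 ^ n * fact n)"
proof (induction n)
  case 0
  show ?case by (simp add: Gamma_one_half_real)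
next
  case (Suc n)
  have "real n + 1 / 2 \<notin> \<int>\<^sub>\<le>\<^sub>0"
    by (auto elim!: nonpos_Ints_cases')
  from Gamma_plus1[OF this]
  have G: "Gamma (real (Suc n) + 1 / 2) = (real n + 1 / 2) * Gamma (real n + 1 / 2)"
    by (simp add: algebra_simps)
  \<comment> \<open>The new factors of the factorial are (2n+2)(2n+1) = 2c(2c-1); naming
    \<open>c\<close> leaves a plain cancellation.\<close>
  define c where "c = real n + 1"
  have "c \<noteq> 0" by (simp add: c_def)
  have F: "(fact (2 * Suc n) :: real) = 2 * (2 * c - 1) * (fact (2 * n) * c)"
    by (simp add: c_def algebra_simps)
  have "(fact (Suc n) :: real) = c * fact n" "real n + 1 / 2 = (2 * c - 1) / 2"
    by (simp_all add: c_def field_simps)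
  then show ?case
    unfolding G F Suc.IH using \<open>c \<noteq> 0\<close> by (simp add: divide_simps del: fact_Suc)
qed

text \<open>Reflection reverses the sign of the index difference and makes \<open>j div 2\<close>
  the upper limit of the sum. As a is not an integer, every summand falls in the Gamma case, and the
  sine factors out.\<close>

lemma K_crit_reflected:
  assumes "i < \<Delta>" "j < \<Delta>" and a: "a = (real i - real j) / 2" "a \<notin> \<int>"
  shows "K_crit \<Delta> (\<Delta> - 1 - i) (\<Delta> - 1 - j)
       = sin (pi * a) / (2 * pi) * (Gamma (real (j div 2) + a + 1) / (fact (j div 2) * a))"
proof -
  have diff: "real (\<Delta> - 1 - j) - real (\<Delta> - 1 - i) = 2 * a"
    using assms by (simp add: of_nat_diff Suc_le_eq)
  have top: "\<Delta> - (\<Delta> - 1 - j) - 1 = j"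
    using assms by simp
  have "real l + a \<notin> \<int>\<^sub>\<le>\<^sub>0" for l
    using a(2) nonpos_Ints_Int[of "real l + a"] by (auto simp: add_in_Ints_iff_right)
  then have "K_crit \<Delta> (\<Delta> - 1 - i) (\<Delta> - 1 - j)
      = (\<Sum>l=0..j div 2. sin (pi * a) / (2 * pi) * (Gamma (real l + a) / fact l))"
    unfolding K_crit_def diff top by (intro sum.cong) auto
  then show ?thesis
    unfolding sum_distrib_left[symmetric] sum_Gamma_shift_over_fact[OF a(2)] .
qed

section \<open>Comparison of the two closed forms\<close>

lemma sin_pi_half_integer:
  "sin (pi * (real n - real m - 1 / 2)) = - ((-1) ^ n * (-1) ^ m)"
proof -
  have "sin (pi * (real n - real m - 1 / 2)) = sin ((pi * real n - pi * real m) - pi / 2)"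
    by (simp add: algebra_simps)
  also have "\<dots> = - cos (pi * real n - pi * real m)"
    by (simp only: sin_diff cos_pi_half sin_pi_half mult_zero_right mult_1_right diff_0)
  finally show ?thesis by (simp add: cos_diff)
qed

lemma powr_half_integer:
  "(2::real) powr (real n - real m - 1 / 2) = 2 ^ n / (2 ^ m * sqrt 2)"
  by (simp add: powr_diff powr_realpow powr_half_sqrt)

text \<open>With m = \<open>j div 2\<close>, this covers both parities: (i, j) = (2n-1, 2m) and (i,
  j) = (2n, 2m+1) have the same half-difference a. Then m + a + 1 = n + 1/2, and the factorials,
  signs and powers of 2 assemble into H_(2n)(0) H_(2m)(0).\<close>

lemma half_integer_closed_form:
  fixes n m :: nat
  defines "a \<equiv> real n - real m - 1 / 2"
  shows "2 powr a * (sin (pi * a) / (2 * pi) * (Gamma (real m + a + 1) / (fact m * a)))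
       = - poly (hermite_rec (2 * n)) 0 * poly (hermite_rec (2 * m)) 0 / (fact (2 * m) * (2 * a) * sqrt (2 * pi))"
proof -
  have "a \<noteq> 0"
  proof
    assume "a = 0"
    then have "real (2 * n) = real (2 * m + 1)" unfolding a_def by simp
    then have "2 * n = 2 * m + 1" by (simp only: of_nat_eq_iff)
    then show False by presburger
  qed
  define s where "s = sqrt pi"
  have "s \<noteq> 0" by (simp add: s_def)
  have s: "sqrt pi = s" "sqrt (2 * pi) = sqrt 2 * s" "2 * pi = 2 * (s * s)"
    by (simp_all add: s_def real_sqrt_mult)
  have "real m + a + 1 = real n + 1 / 2" by (simp add: a_def)
  then have G: "Gamma (real m + a + 1) = fact (2 * n) * s / (2 ^ n * 2 ^ n * fact n)"
    by (simp only: Gamma_nat_plus_half s(1) flip: power_mult_distrib) simp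
  have S: "sin (pi * a) = - ((-1) ^ n * (-1) ^ m)" "2 powr a = 2 ^ n / (2 ^ m * sqrt 2)"
    unfolding a_def by (rule sin_pi_half_integer powr_half_integer)+
  show ?thesis
    \<comment> \<open>\<open>s(2)\<close> acts before \<open>s(3)\<close>, which would otherwise
      rewrite the argument of \<open>sqrt (2 * pi)\<close>.\<close>
    unfolding G S poly_hermite_rec_even_odd_0 s(2) unfolding s(3) using \<open>a \<noteq> 0\<close> \<open>s \<noteq> 0\<close>
    by (simp add: divide_simps)
qed

lemma reflected_K_crit_eq_K_0:
  assumes "i < \<Delta>" "j < \<Delta>" "(real i - real j) / 2 \<notin> \<int>"
  shows "2 powr ((real i - real j) / 2) * K_crit \<Delta> (\<Delta> - 1 - i) (\<Delta> - 1 - j) = K_0 i j"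
proof -
  define a where "a = (real i - real j) / 2"
  define I where "I = (LBINT t:{0..}. exp (- t\<^sup>2 / 2) * poly (hermite_rec i) t * poly (hermite_rec j) t)"
  have "a \<noteq> 0" using assms(3) by (auto simp: a_def)
  have "odd (i + j)"
  proof
    assume "even (i + j)"
    then have "even (int i - int j)" by simp
    then obtain k where "int i - int j = 2 * k" ..
    then have "real_of_int (int i - int j) = 2 * of_int k" by simp
    then have "(real i - real j) / 2 = of_int k" by simp
    then show False using assms(3) by simp
  qed
  have two_a: "- (2 * a) = real j - real i" unfolding a_def by argo
  have I: "- (2 * a) * I = poly (hermite_rec j) 0 * poly (hermite_rec (Suc i)) 0
      - poly (hermite_rec i) 0 * poly (hermite_rec (Suc j)) 0"
    unfolding two_a I_def by (rule half_line_hermite_rec)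
  have "a \<notin> \<int>" using assms(3) by (simp only: a_def not_False_eq_True)
  have K: "2 powr a * K_crit \<Delta> (\<Delta> - 1 - i) (\<Delta> - 1 - j)
      = - poly (hermite_rec (2 * n)) 0 * poly (hermite_rec (2 * m)) 0 / (fact (2 * m) * (2 * a) * sqrt (2 * pi))"
    if "a = real n - real m - 1 / 2" "j div 2 = m" for n m
    unfolding K_crit_reflected[OF assms(1,2) a_def \<open>a \<notin> \<int>\<close>] that(2)
    using half_integer_closed_form[of n m] unfolding that(1)[symmetric] .
  have "2 powr a * K_crit \<Delta> (\<Delta> - 1 - i) (\<Delta> - 1 - j) = I / (sqrt (2 * pi) * fact j)"
  proof (cases "even j")
    case True
    then obtain m where m: "j = 2 * m" ..
    with \<open>odd (i + j)\<close> obtain n where n: "i = 2 * n + 1" by (auto elim: oddE)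
    \<comment> \<open>Here i is odd, so H_i(0) = 0 removes the second product in
      \<open>I\<close>.\<close>
    have "- (2 * a) * I = poly (hermite_rec (2 * m)) 0 * poly (hermite_rec (2 * Suc n)) 0"
      using I poly_hermite_rec_even_odd_0(2) by (simp add: m n del: hermite_rec.simps)
    then have I_eq: "I = - poly (hermite_rec (2 * Suc n)) 0 * poly (hermite_rec (2 * m)) 0 / (2 * a)"
      using \<open>a \<noteq> 0\<close> by (simp add: field_simps del: hermite_rec.simps)
    have "a = real (Suc n) - real m - 1 / 2" by (simp add: a_def m n field_simps)
    from K[OF this, unfolded m] show ?thesis
      by (simp add: I_eq m del: hermite_rec.simps)
  next
    case False
    then obtain m where m: "j = 2 * m + 1" ..
    with \<open>odd (i + j)\<close> obtain n where n: "i = 2 * n" by auto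
    \<comment> \<open>Now j is odd, so the first product in \<open>I\<close> vanishes
      instead.\<close>
    have "2 * a * I = poly (hermite_rec (2 * n)) 0 * poly (hermite_rec (2 * Suc m)) 0"
      using I poly_hermite_rec_even_odd_0(2) by (simp add: m n del: hermite_rec.simps)
    \<comment> \<open>Going down from H_(j+1)(0) to H_(j-1)(0) produces a factor j, which reduces
      the j! of \<open>K_0\<close> to the (2m)! of the closed form.\<close>
    moreover have "poly (hermite_rec (2 * Suc m)) 0 = - real j * poly (hermite_rec (2 * m)) 0"
      using poly_hermite_rec_Suc_0[of j] pderiv_hermite_rec_Suc[of "2 * m"]
      by (simp add: m algebra_simps del: hermite_rec.simps)
    ultimately have I_eq: "I = - real j * poly (hermite_rec (2 * n)) 0 * poly (hermite_rec (2 * m)) 0 / (2 * a)"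
      using \<open>a \<noteq> 0\<close> by (simp add: field_simps del: hermite_rec.simps)
    have fact_j: "(fact j :: real) = real j * fact (2 * m)" and "real j \<noteq> 0"
      by (simp_all add: m)
    have "a = real n - real m - 1 / 2" "j div 2 = m" by (simp_all add: a_def m n field_simps)
    from K[OF this] show ?thesis
      using \<open>real j \<noteq> 0\<close> by (simp add: I_eq fact_j del: hermite_rec.simps)
  qed
  then show ?thesis
    by (simp add: K_0_def He_eq_hermite_rec I_def a_def)
qed

theorem theorem4p1:
  fixes \<Delta> :: nat
  assumes "\<Delta> > 0"
  shows "\<forall>i \<in> {0..\<Delta> - 1}. \<forall>j \<in> {0..\<Delta> - 1}. (real j - real i) / 2 \<notin> \<int> \<longrightarrow>
           2 powr ((real i - real j) / 2) * K_crit \<Delta> (\<Delta> - 1 - i) (\<Delta> - 1 - j) = K_0 i j"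
proof (intro ballI impI)
  fix i j
  assume "i \<in> {0..\<Delta> - 1}" "j \<in> {0..\<Delta> - 1}" and "(real j - real i) / 2 \<notin> \<int>"
  moreover have "(real j - real i) / 2 = - ((real i - real j) / 2)"
    by (simp only: minus_divide_left minus_diff_eq)
  \<comment> \<open>Natural subtraction is truncated, so positivity of \<Delta> is what makes the
    bound by \<Delta> - 1 strict.\<close>
  ultimately have "i < \<Delta>" "j < \<Delta>" "(real i - real j) / 2 \<notin> \<int>"
    using assms by (auto simp only: minus_in_Ints_iff atLeastAtMost_iff)
  then show "2 powr ((real i - real j) / 2) * K_crit \<Delta> (\<Delta> - 1 - i) (\<Delta> - 1 - j) = K_0 i j"
    by (rule reflected_K_crit_eq_K_0)
qed

end
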